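(* Let $R$ be an integral domain with quotient field $K$ and let $I$ be a strongly prime ideal of $R$. Then $I$ is a strongly 2-absorbing ideal of $R$.
   Context: Let $R$ be an integral domain with quotient field $K$. A proper ideal $I$ of $R$ is strongly prime if, whenever $xy\in I$ for elements $x,y\in K$, then $x\in I$ or $y\in I$. A proper ideal $I$ of $R$ is 2-absorbing if whenever $a,b,c\in R$ and $abc\in I$, then $ab\in I$ or $ac\in I$ or $bc\in I$. A 2-absorbing ideal $I$ of $R$ is a strongly 2-absorbing ideal if, whenever $xyz\in I$ for elements $x,y,z\in K$, we have $xy\in I$ or $yz\in I$ or $xz\in I$. *)

theory Defs
  imports "HOL-Algebra.Ideal" "HOL-Algebra.Subrings"
begin

text \<open>
  An integral domain \<open>R\<close> with quotient field \<open>K\<close> is represented as a subdomain of \<open>K\<close>, i.e. the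
  embedding of \<open>R\<close> into its quotient field is taken to be an inclusion: \<open>R\<close> is a subset of the
  carrier of \<open>K\<close>, and the ring that it forms is \<open>K\<lparr>carrier := R\<rparr>\<close>.
\<close>

definition quotient_field :: "'a set \<Rightarrow> ('a, 'b) ring_scheme \<Rightarrow> bool" where
  "quotient_field R K \<longleftrightarrow> field K \<and> subdomain R K \<and>
     (\<forall>x \<in> carrier K. \<exists>a \<in> R. \<exists>b \<in> R - {\<zero>\<^bsub>K\<^esub>}. x = a \<otimes>\<^bsub>K\<^esub> inv\<^bsub>K\<^esub> b)"

definition proper_ideal :: "'a set \<Rightarrow> ('a, 'b) ring_scheme \<Rightarrow> bool" where
  "proper_ideal I A \<longleftrightarrow> ideal I A \<and> I \<noteq> carrier A"

definition two_absorbing_ideal :: "'a set \<Rightarrow> ('a, 'b) ring_scheme \<Rightarrow> bool" where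
  "two_absorbing_ideal I A \<longleftrightarrow> proper_ideal I A \<and>
     (\<forall>a \<in> carrier A. \<forall>b \<in> carrier A. \<forall>c \<in> carrier A.
        a \<otimes>\<^bsub>A\<^esub> b \<otimes>\<^bsub>A\<^esub> c \<in> I \<longrightarrow> a \<otimes>\<^bsub>A\<^esub> b \<in> I \<or> a \<otimes>\<^bsub>A\<^esub> c \<in> I \<or> b \<otimes>\<^bsub>A\<^esub> c \<in> I)"

text \<open>
  In the next two definitions \<open>I\<close> is an ideal of \<open>R\<close>, but the elements \<open>x, y, z\<close> range over all
  of \<open>K\<close>.
\<close>

definition strongly_prime_ideal :: "'a set \<Rightarrow> 'a set \<Rightarrow> ('a, 'b) ring_scheme \<Rightarrow> bool" where
  "strongly_prime_ideal I R K \<longleftrightarrow> proper_ideal I (K\<lparr>carrier := R\<rparr>) \<and>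
     (\<forall>x \<in> carrier K. \<forall>y \<in> carrier K. x \<otimes>\<^bsub>K\<^esub> y \<in> I \<longrightarrow> x \<in> I \<or> y \<in> I)"

definition strongly_two_absorbing_ideal :: "'a set \<Rightarrow> 'a set \<Rightarrow> ('a, 'b) ring_scheme \<Rightarrow> bool" where
  "strongly_two_absorbing_ideal I R K \<longleftrightarrow> two_absorbing_ideal I (K\<lparr>carrier := R\<rparr>) \<and>
     (\<forall>x \<in> carrier K. \<forall>y \<in> carrier K. \<forall>z \<in> carrier K.
        x \<otimes>\<^bsub>K\<^esub> y \<otimes>\<^bsub>K\<^esub> z \<in> I \<longrightarrow> x \<otimes>\<^bsub>K\<^esub> y \<in> I \<or> y \<otimes>\<^bsub>K\<^esub> z \<in> I \<or> x \<otimes>\<^bsub>K\<^esub> z \<in> I)"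

end

theory Submission
  imports Defs
begin

text \<open>Bracket the product in two ways. Strong primeness applied to (xy)z gives xy \<in> I or z
  \<in> I; applied to x(yz) it gives x \<in> I or yz \<in> I. If neither xy nor yz lies in I, then
  both x and z do, and hence so does xz.\<close>

theorem proposition3p2:
  fixes K :: "('a, 'b) ring_scheme" and R I :: "'a set"
  assumes "quotient_field R K"
    and "strongly_prime_ideal I R K"
  shows "strongly_two_absorbing_ideal I R K"
proof -
  interpret field K
    using assms(1) by (simp add: quotient_field_def)
  have R_sub: "R \<subseteq> carrier K"
    using assms(1) subdomainE(1) by (auto simp: quotient_field_def)
  have proper: "proper_ideal I (K\<lparr>carrier := R\<rparr>)"
    and prime: "\<And>x y. \<lbrakk>x \<in> carrier K; y \<in> carrier K; x \<otimes>\<^bsub>K\<^esub> y \<in> I\<rbrakk> \<Longrightarrow> x \<in> I \<or> y \<in> I"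
    using assms(2) by (auto simp: strongly_prime_ideal_def)
  interpret I: ideal I "K\<lparr>carrier := R\<rparr>"
    using proper by (simp add: proper_ideal_def)
  \<comment> \<open>I absorbs factors from R only, so for x, y, z in K one factor in I would not
    suffice; with both in I, one of them serves as the element of R.\<close>
  have mult_closed: "x \<otimes>\<^bsub>K\<^esub> y \<in> I" if "x \<in> I" "y \<in> I" for x y
    using that I.I_l_closed I.a_subset by auto
  have absorbing: "x \<otimes>\<^bsub>K\<^esub> y \<in> I \<or> y \<otimes>\<^bsub>K\<^esub> z \<in> I \<or> x \<otimes>\<^bsub>K\<^esub> z \<in> I"
    if K: "x \<in> carrier K" "y \<in> carrier K" "z \<in> carrier K" and xyz: "x \<otimes>\<^bsub>K\<^esub> y \<otimes>\<^bsub>K\<^esub> z \<in> I" for x y z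
  proof -
    have "x \<otimes>\<^bsub>K\<^esub> y \<in> I \<or> z \<in> I"
      using prime[of "x \<otimes>\<^bsub>K\<^esub> y" z] K xyz by simp
    moreover have "x \<in> I \<or> y \<otimes>\<^bsub>K\<^esub> z \<in> I"
      using prime[of x "y \<otimes>\<^bsub>K\<^esub> z"] K xyz by (simp add: m_assoc)
    ultimately show ?thesis
      using mult_closed by blast
  qed
  \<comment> \<open>R inherits its multiplication from K, so this is \<open>absorbing\<close>
    restricted to elements of R, with the alternatives reordered.\<close>
  have "two_absorbing_ideal I (K\<lparr>carrier := R\<rparr>)"
    unfolding two_absorbing_ideal_def using proper absorbing R_sub by (simp, blast)
  then show ?thesis
    unfolding strongly_two_absorbing_ideal_def using absorbing by blast
qed

end
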